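(* Let $1\le m<n$ be integers, let $\mu$ be a measure on $\mathbb{R}$ with finite moments such that $H_k[\mu]\neq0$ for $1\le k\le n-m$, let $\nu^{(1)},\dots,\nu^{(m)}$ and $\eta^{(1)},\dots,\eta^{(m)}$ be (possibly signed or complex) measures on $\mathbb{R}$, each with finite moments, and let $A=(a_{jk})_{j,k=1}^m$ be an $m\times m$ matrix. Then $$H_n^F[\mu;\nu^{(1)},\dots,\nu^{(m)};\eta^{(1)},\dots,\eta^{(m)};A]=H_{n-m}[\mu]\,\det\left[A-\left(\int_{\mathbb{R}}\int_{\mathbb{R}}K_{n-m-1}(x_k,y_j)\,\mathrm{d}\nu^{(k)}(x_k)\,\mathrm{d}\eta^{(j)}(y_j)\right)_{j,k=1}^m\right].$$
   Context: For a measure on $\mathbb{R}$ with finite moments, a subscript $k$ denotes its $k$th moment, e.g. $\mu_k=\int_{\mathbb{R}}x^k\,\mathrm{d}\mu(x)$. $H_k[\mu]=\det(\mu_{i+j})_{0\le i,j\le k-1}$. The framed Hankel determinant is the $n\times n$ determinant $$H_n^F[\mu;\nu^{(1)},\dots,\nu^{(m)};\eta^{(1)},\dots,\eta^{(m)};A]=\det\begin{pmatrix}\mu_0&\mu_1&\cdots&\mu_{n-m-1}&\nu^{(1)}_0&\cdots&\nu^{(m)}_0\\ \mu_1&\mu_2&\cdots&\mu_{n-m}&\nu^{(1)}_1&\cdots&\nu^{(m)}_1\\ \vdots&\vdots&\ddots&\vdots&\vdots&\ddots&\vdots\\ \mu_{n-m-1}&\mu_{n-m}&\cdots&\mu_{2(n-m-1)}&\nu^{(1)}_{n-m-1}&\cdots&\nu^{(m)}_{n-m-1}\\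 \eta^{(1)}_0&\eta^{(1)}_1&\cdots&\eta^{(1)}_{n-m-1}&a_{11}&\cdots&a_{1m}\\ \vdots&\vdots&\ddots&\vdots&\vdots&\ddots&\vdots\\ \eta^{(m)}_0&\eta^{(m)}_1&\cdots&\eta^{(m)}_{n-m-1}&a_{m1}&\cdots&a_{mm}\end{pmatrix}.$$ $P_k$ denotes the monic orthogonal polynomial of degree $k$ with respect to $\mu$: $\int_{\mathbb{R}}P_k(x)P_j(x)\,\mathrm{d}\mu(x)=h_k\delta_{jk}$, and $K_n(x,y)=\sum_{k=0}^n\frac{P_k(x)P_k(y)}{h_k}$. *)

theory Defs
  imports
    "HOL-Analysis.Bochner_Integration"
    "HOL-Computational_Algebra.Polynomial"
    "Jordan_Normal_Form.Determinant"
begin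

section \<open>Complex measures on the real line\<close>

text \<open>A complex measure is a countably additive complex-valued set function on the Borel sets
  (additivity along the empty sequence gives \<open>\<nu> {} = 0\<close>). Only the values on Borel sets matter.
  Signed measures are the real-valued ones. Since the zeroth moment has to be finite, infinite
  total variation never arises.\<close>

definition complex_measure :: "(real set \<Rightarrow> complex) \<Rightarrow> bool" where
  "complex_measure \<nu> \<longleftrightarrow>
     (\<forall>E :: nat \<Rightarrow> real set. range E \<subseteq> sets borel \<longrightarrow> disjoint_family E \<longrightarrow>
        (\<lambda>i. \<nu> (E i)) sums \<nu> (\<Union>i. E i))"

text \<open>The positive variation of the Jordan decomposition,
  \<open>\<sigma>\<^sup>+(E) = sup {\<sigma>(F) | F \<subseteq> E Borel}\<close>. Truncation of negative values by \<open>ennreal\<close> is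
  harmless, because \<open>F = {}\<close> is admissible. The negative variation is the positive variation of
  \<open>-\<sigma>\<close>.\<close>

definition pos_var :: "(real set \<Rightarrow> real) \<Rightarrow> real measure" where
  "pos_var \<sigma> = measure_of UNIV (sets borel)
     (\<lambda>E. SUP F\<in>{F \<in> sets borel. F \<subseteq> E}. ennreal (\<sigma> F))"

abbreviation re_pos :: "(real set \<Rightarrow> complex) \<Rightarrow> real measure" where
  "re_pos \<nu> \<equiv> pos_var (\<lambda>E. Re (\<nu> E))"
abbreviation re_neg :: "(real set \<Rightarrow> complex) \<Rightarrow> real measure" where
  "re_neg \<nu> \<equiv> pos_var (\<lambda>E. - Re (\<nu> E))"
abbreviation im_pos :: "(real set \<Rightarrow> complex) \<Rightarrow> real measure" where
  "im_pos \<nu> \<equiv> pos_var (\<lambda>E. Im (\<nu> E))"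
abbreviation im_neg :: "(real set \<Rightarrow> complex) \<Rightarrow> real measure" where
  "im_neg \<nu> \<equiv> pos_var (\<lambda>E. - Im (\<nu> E))"

text \<open>Integrability against all four parts is integrability against the total variation.\<close>

definition cm_integrable :: "(real set \<Rightarrow> complex) \<Rightarrow> (real \<Rightarrow> complex) \<Rightarrow> bool" where
  "cm_integrable \<nu> f \<longleftrightarrow>
     integrable (re_pos \<nu>) f \<and> integrable (re_neg \<nu>) f \<and>
     integrable (im_pos \<nu>) f \<and> integrable (im_neg \<nu>) f"

definition cm_integral :: "(real set \<Rightarrow> complex) \<Rightarrow> (real \<Rightarrow> complex) \<Rightarrow> complex" where
  "cm_integral \<nu> f =
     (integral\<^sup>L (re_pos \<nu>) f - integral\<^sup>L (re_neg \<nu>) f)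
     + \<i> * (integral\<^sup>L (im_pos \<nu>) f - integral\<^sup>L (im_neg \<nu>) f)"

definition finite_moments :: "(real set \<Rightarrow> complex) \<Rightarrow> bool" where
  "finite_moments \<nu> \<longleftrightarrow> (\<forall>k :: nat. cm_integrable \<nu> (\<lambda>x. complex_of_real x ^ k))"

definition moment :: "(real set \<Rightarrow> complex) \<Rightarrow> nat \<Rightarrow> complex" where
  "moment \<nu> k = cm_integral \<nu> (\<lambda>x. complex_of_real x ^ k)"

subsection \<open>The variation is a measure, and positive measures are covered\<close>

lemma complex_measure_empty:
  assumes "complex_measure \<nu>"
  shows "\<nu> {} = 0"
proof -
  have "(\<lambda>i::nat. \<nu> {}) sums \<nu> (\<Union>i::nat. {})"
    using assms unfolding complex_measure_def
    by (elim allE[of _ "\<lambda>_. {}"]) (auto simp: disjoint_family_on_def)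
  then have "summable (\<lambda>i::nat. \<nu> {})" by (rule sums_summable)
  then show ?thesis by (simp add: summable_const_iff)
qed

lemma emeasure_pos_var:
  fixes \<sigma> :: "real set \<Rightarrow> real"
  assumes add: "\<And>E :: nat \<Rightarrow> real set. range E \<subseteq> sets borel \<Longrightarrow> disjoint_family E \<Longrightarrow>
                  (\<lambda>i. \<sigma> (E i)) sums \<sigma> (\<Union>i. E i)"
    and E: "E \<in> sets borel"
  shows "emeasure (pos_var \<sigma>) E = (SUP F\<in>{F \<in> sets borel. F \<subseteq> E}. ennreal (\<sigma> F))"
proof -
  define v where "v E = (SUP F\<in>{F \<in> sets borel. F \<subseteq> E}. ennreal (\<sigma> F))" for E :: "real set"
  have "(\<lambda>i::nat. \<sigma> {}) sums \<sigma> (\<Union>i::nat. {})"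
    by (rule add) (auto simp: disjoint_family_on_def)
  then have "summable (\<lambda>i::nat. \<sigma> {})" by (rule sums_summable)
  then have emp: "\<sigma> {} = 0" by (simp add: summable_const_iff)
  have v_emp: "v {} = 0"
    by (simp add: v_def emp conj_commute cong: conj_cong)
  have upper: "ennreal (\<sigma> F) \<le> v B" if "F \<in> sets borel" "F \<subseteq> B" for F B
    unfolding v_def using that by (intro SUP_upper) auto
  have "(\<Sum>i. v (B i)) = v (\<Union>i. B i)"
    if B: "range B \<subseteq> sets borel" and disj: "disjoint_family B" for B :: "nat \<Rightarrow> real set"
  proof (rule antisym)
    show "v (\<Union>i. B i) \<le> (\<Sum>i. v (B i))"
      unfolding v_def[of "\<Union>i. B i"]
    proof (rule SUP_least, clarify)
      fix F :: "real set" assume F: "F \<in> sets borel" "F \<subseteq> (\<Union>i. B i)"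
      have "disjoint_family (\<lambda>i. F \<inter> B i)"
        using disj unfolding disjoint_family_on_def by blast
      then have "(\<lambda>i. \<sigma> (F \<inter> B i)) sums \<sigma> (\<Union>i. F \<inter> B i)"
        using F B by (intro add) auto
      moreover have "(\<Union>i. F \<inter> B i) = F" using F by auto
      ultimately have "(\<lambda>n. ennreal (\<Sum>i<n. \<sigma> (F \<inter> B i))) \<longlonglongrightarrow> ennreal (\<sigma> F)"
        by (simp add: sums_def tendsto_ennrealI)
      then show "ennreal (\<sigma> F) \<le> (\<Sum>i. v (B i))"
      proof (rule LIMSEQ_le_const2, intro exI allI impI)
        fix n
        have "ennreal (\<Sum>i<n. \<sigma> (F \<inter> B i)) \<le> ennreal (\<Sum>i<n. max 0 (\<sigma> (F \<inter> B i)))"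
          by (intro ennreal_leI sum_mono) auto
        also have "\<dots> = (\<Sum>i<n. ennreal (\<sigma> (F \<inter> B i)))"
          by (subst sum_ennreal[symmetric]) (auto simp: max_def ennreal_neg simp del: sum_ennreal intro!: sum.cong)
        also have "\<dots> \<le> (\<Sum>i<n. v (B i))"
          using F B by (intro sum_mono upper) auto
        also have "\<dots> \<le> (\<Sum>i. v (B i))" by (rule sum_le_suminf) auto
        finally show "ennreal (\<Sum>i<n. \<sigma> (F \<inter> B i)) \<le> (\<Sum>i. v (B i))" .
      qed
    qed
  next
    have fin: "v C + v D \<le> v (C \<union> D)" if CD: "C \<inter> D = {}" for C D
    proof -
      have bin: "\<sigma> (F \<union> G) = \<sigma> F + \<sigma> G"
        if "F \<in> sets borel" "G \<in> sets borel" "F \<inter> G = {}" for F G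
      proof -
        have "(\<lambda>i. \<sigma> (binaryset F G i)) sums \<sigma> (\<Union>i. binaryset F G i)"
          using that by (intro add) (auto simp: binaryset_def disjoint_family_on_def)
        moreover have "(\<lambda>i. \<sigma> (binaryset F G i)) sums (\<sigma> F + \<sigma> G)"
          using sums_finite[of "{0, Suc 0}" "\<lambda>i. \<sigma> (binaryset F G i)"] emp
          by (simp add: binaryset_def)
        ultimately show ?thesis by (simp add: UN_binaryset_eq sums_unique2)
      qed
      have step: "ennreal (\<sigma> F) + ennreal (\<sigma> G) \<le> v (C \<union> D)"
        if FG: "F \<in> sets borel" "F \<subseteq> C" "G \<in> sets borel" "G \<subseteq> D" for F G
      proof -
        consider "\<sigma> F \<le> 0" | "\<sigma> G \<le> 0" | "0 \<le> \<sigma> F" "0 \<le> \<sigma> G" by linarith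
        then show ?thesis
        proof cases
          case 1 then show ?thesis using upper[of G "C \<union> D"] FG by (auto simp: ennreal_neg)
        next
          case 2 then show ?thesis using upper[of F "C \<union> D"] FG by (auto simp: ennreal_neg)
        next
          case 3
          have "F \<inter> G = {}" using FG CD by auto
          then show ?thesis
            using 3 FG upper[of "F \<union> G" "C \<union> D"] bin[of F G]
            by (auto simp: ennreal_plus[symmetric] simp del: ennreal_plus)
        qed
      qed
      have "v C + v D = (SUP F\<in>{F \<in> sets borel. F \<subseteq> C}. ennreal (\<sigma> F) + v D)"
        unfolding v_def[of C] by (rule ennreal_SUP_add_left[symmetric]) auto
      also have "\<dots> \<le> v (C \<union> D)"
      proof (rule SUP_least, clarify)
        fix F :: "real set" assume F: "F \<in> sets borel" "F \<subseteq> C"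
        have "ennreal (\<sigma> F) + v D = (SUP G\<in>{G \<in> sets borel. G \<subseteq> D}. ennreal (\<sigma> F) + ennreal (\<sigma> G))"
          unfolding v_def add.commute[of "ennreal (\<sigma> F)"]
          by (rule ennreal_SUP_add_left[symmetric]) auto
        also have "\<dots> \<le> v (C \<union> D)" using F step by (auto intro!: SUP_least)
        finally show "ennreal (\<sigma> F) + v D \<le> v (C \<union> D)" .
      qed
      finally show ?thesis .
    qed
    have mono: "v C \<le> v D" if "C \<subseteq> D" for C D
      unfolding v_def using that by (intro SUP_subset_mono) auto
    have "(\<Sum>i<n. v (B i)) \<le> v (\<Union>i<n. B i)" for n
    proof (induction n)
      case (Suc n)
      have "B i \<inter> B n = {}" if "i < n" for i
        using disj that by (simp add: disjoint_family_on_def)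
      then have "(\<Union>i<n. B i) \<inter> B n = {}" by blast
      note fin = fin[OF this]
      have "(\<Sum>i<Suc n. v (B i)) \<le> v (\<Union>i<n. B i) + v (B n)"
        using Suc by (simp add: add_right_mono)
      also have "\<dots> \<le> v ((\<Union>i<n. B i) \<union> B n)" by (rule fin)
      also have "(\<Union>i<n. B i) \<union> B n = (\<Union>i<Suc n. B i)" by (auto simp: lessThan_Suc)
      finally show ?case .
    qed (simp add: v_emp)
    then have "(\<Sum>i<n. v (B i)) \<le> v (\<Union>i. B i)" for n
      by (rule order_trans) (rule mono, auto)
    then show "(\<Sum>i. v (B i)) \<le> v (\<Union>i. B i)"
      by (intro suminf_le_const) auto
  qed
  then have ca: "countably_additive (sets borel) v"
    by (auto simp: countably_additive_def)
  have "emeasure (pos_var \<sigma>) E = v E"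
  proof (rule emeasure_measure_of[where \<Omega> = UNIV and A = "sets borel"])
    show "pos_var \<sigma> = measure_of UNIV (sets borel) v"
      unfolding pos_var_def v_def ..
    have "sets (pos_var \<sigma>) = sets borel"
      unfolding pos_var_def using sets.sigma_sets_eq[of borel] by (simp add: sets_measure_of)
    then show "E \<in> sets (pos_var \<sigma>)" "countably_additive (sets (pos_var \<sigma>)) v"
      using E ca by auto
    show "positive (sets (pos_var \<sigma>)) v" by (simp add: positive_def v_emp)
  qed auto
  then show ?thesis by (simp add: v_def)
qed

text \<open>A positive Borel measure with finite moments is finite, so the following embedding makes it a
  complex measure, with the usual notions of integrability and integral.\<close>

definition cm_of_measure :: "real measure \<Rightarrow> real set \<Rightarrow> complex" where
  "cm_of_measure M E = complex_of_real (measure M E)"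

lemma sets_pos_var [simp]: "sets (pos_var \<sigma>) = sets borel"
  unfolding pos_var_def using sets.sigma_sets_eq[of borel] by (simp add: sets_measure_of)

lemma
  assumes "finite_measure M" and [simp]: "sets M = sets borel"
  shows complex_measure_cm_of_measure: "complex_measure (cm_of_measure M)"
    and cm_integrable_cm_of_measure: "cm_integrable (cm_of_measure M) f \<longleftrightarrow> integrable M f"
    and cm_integral_cm_of_measure: "cm_integral (cm_of_measure M) f = integral\<^sup>L M f"
proof -
  interpret finite_measure M by fact
  have add: "(\<lambda>i. measure M (E i)) sums measure M (\<Union>i. E i)"
    if "range E \<subseteq> sets borel" "disjoint_family E" for E :: "nat \<Rightarrow> real set"
    using that by (intro finite_measure_UNION) auto
  show "complex_measure (cm_of_measure M)"
    unfolding complex_measure_def cm_of_measure_def using add by (auto intro: sums_of_real)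
  have re_pos: "re_pos (cm_of_measure M) = M"
  proof (rule measure_eqI)
    fix E assume "E \<in> sets (re_pos (cm_of_measure M))"
    then have E: "E \<in> sets borel" by simp
    have "emeasure (re_pos (cm_of_measure M)) E
        = (SUP F\<in>{F \<in> sets borel. F \<subseteq> E}. ennreal (measure M F))"
      using emeasure_pos_var[of "\<lambda>E. measure M E", OF add E] by (simp add: cm_of_measure_def)
    also have "\<dots> = emeasure M E"
      using E by (intro antisym SUP_least SUP_upper2[of E])
                 (auto simp: emeasure_eq_measure intro!: ennreal_leI finite_measure_mono)
    finally show "emeasure (re_pos (cm_of_measure M)) E = emeasure M E" .
  qed simp
  have null: "pos_var \<sigma> = null_measure borel" if "\<And>F. \<sigma> F \<le> 0" for \<sigma>
  proof -
    have "(SUP F\<in>{F \<in> sets borel. F \<subseteq> E}. ennreal (\<sigma> F)) = 0" for E :: "real set"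
      using that by (intro antisym SUP_least) (auto simp: ennreal_neg)
    then show ?thesis by (simp add: pos_var_def null_measure_def)
  qed
  have zero: "re_neg (cm_of_measure M) = null_measure borel"
     "im_pos (cm_of_measure M) = null_measure borel"
     "im_neg (cm_of_measure M) = null_measure borel"
    by (auto intro!: null simp: cm_of_measure_def)
  have nul: "integral\<^sup>L (null_measure borel) f = 0"
    by (cases "integrable (null_measure borel) f")
       (auto simp: not_integrable_integral_eq intro!: integral_eq_zero_AE AE_I[of _ _ UNIV])
  have nul_int: "integrable (null_measure borel) f" if "f \<in> borel_measurable borel"
    using that by (intro integrableI_bounded) auto
  have "f \<in> borel_measurable borel" if "integrable M f"
    using borel_measurable_integrable[OF that]
    by (subst measurable_cong_sets[of borel M borel borel, OF _ refl]) simp_all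
  then show "cm_integrable (cm_of_measure M) f \<longleftrightarrow> integrable M f"
    unfolding cm_integrable_def re_pos zero using nul_int by blast
  show "cm_integral (cm_of_measure M) f = integral\<^sup>L M f"
    unfolding cm_integral_def re_pos zero nul by simp
qed

section \<open>Hankel determinants and orthogonal polynomials\<close>

definition hankel_det :: "(real set \<Rightarrow> complex) \<Rightarrow> nat \<Rightarrow> complex" where
  "hankel_det \<mu> k = det (mat k k (\<lambda>(i, j). moment \<mu> (i + j)))"

text \<open>The families \<open>\<nu>\<close>, \<open>\<eta>\<close> and the matrix \<open>A\<close> are indexed by \<open>0, \<dots>, m - 1\<close>.\<close>

definition framed_hankel_det ::
  "nat \<Rightarrow> nat \<Rightarrow> (real set \<Rightarrow> complex) \<Rightarrow> (nat \<Rightarrow> real set \<Rightarrow> complex) \<Rightarrow>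
   (nat \<Rightarrow> real set \<Rightarrow> complex) \<Rightarrow> complex mat \<Rightarrow> complex" where
  "framed_hankel_det n m \<mu> \<nu> \<eta> A =
     det (four_block_mat
            (mat (n - m) (n - m) (\<lambda>(i, j). moment \<mu> (i + j)))
            (mat (n - m) m (\<lambda>(i, k). moment (\<nu> k) i))
            (mat m (n - m) (\<lambda>(j, i). moment (\<eta> j) i))
            A)"

text \<open>\<open>P 0, \<dots>, P k\<close> is a monic orthogonal sequence. Restricting to degrees up to \<open>k\<close> is essential:
  only finitely many Hankel determinants are assumed to be nonzero, so no infinite sequence need
  exist. If \<open>hankel_det \<mu> i \<noteq> 0\<close> for \<open>1 \<le> i \<le> k\<close>, then \<open>P 0, \<dots>, P k\<close> exist and are unique.\<close>

definition monic_orth_upto :: "(real set \<Rightarrow> complex) \<Rightarrow> nat \<Rightarrow> (nat \<Rightarrow> complex poly) \<Rightarrow> bool" where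
  "monic_orth_upto \<mu> k P \<longleftrightarrow>
     (\<forall>i\<le>k. degree (P i) = i \<and> lead_coeff (P i) = 1) \<and>
     (\<exists>h :: nat \<Rightarrow> complex. \<forall>i\<le>k. \<forall>j\<le>k.
        cm_integral \<mu> (\<lambda>x. poly (P i) (of_real x) * poly (P j) (of_real x))
          = (if i = j then h i else 0))"

definition orth_poly :: "(real set \<Rightarrow> complex) \<Rightarrow> nat \<Rightarrow> complex poly" where
  "orth_poly \<mu> k = (THE p. \<exists>P. monic_orth_upto \<mu> k P \<and> P k = p)"

definition orth_norm :: "(real set \<Rightarrow> complex) \<Rightarrow> nat \<Rightarrow> complex" where
  "orth_norm \<mu> k =
     cm_integral \<mu> (\<lambda>x. poly (orth_poly \<mu> k) (of_real x) * poly (orth_poly \<mu> k) (of_real x))"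

definition CD_kernel :: "(real set \<Rightarrow> complex) \<Rightarrow> nat \<Rightarrow> real \<Rightarrow> real \<Rightarrow> complex" where
  "CD_kernel \<mu> n x y =
     (\<Sum>k\<le>n. poly (orth_poly \<mu> k) (of_real x) * poly (orth_poly \<mu> k) (of_real y) / orth_norm \<mu> k)"

end

(*
  Idea: let the rows of U be the coefficients of P_0, ..., P_{N-1}, where N = n - m. Orthogonality
  says that U carries the Hankel matrix to U M U^T = diag(h_0, ..., h_{N-1}), and U is unitriangular.
  The same row and column operations turn the frame into the integrals of the P_k against the framing
  measures, and the Schur complement of the diagonal block is A minus the integrated kernel.
*)
theory Submission
  imports Defs
begin

section \<open>Determinants of block and diagonal matrices\<close>

text \<open>Subtracting \<open>C * Mi\<close> times the upper block row from the lower one clears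
  \<open>C\<close> and leaves the Schur complement. The left inverse \<open>Mi\<close> is what turns
  \<open>X * M\<close> into \<open>C\<close>.\<close>

lemma det_schur_complement:
  fixes M :: "'a :: idom mat"
  assumes M: "M \<in> carrier_mat r r" and Mi: "Mi \<in> carrier_mat r r" and inv: "Mi * M = 1\<^sub>m r"
    and B: "B \<in> carrier_mat r s" and C: "C \<in> carrier_mat s r" and A: "A \<in> carrier_mat s s"
  shows "det (four_block_mat M B C A) = det M * det (A - C * Mi * B)"
proof -
  define X where "X = C * Mi"
  have X: "X \<in> carrier_mat s r" using C Mi by (simp add: X_def)
  have XM: "X * M = C"
    using C by (simp add: X_def assoc_mult_mat[OF C Mi M] inv)
  have XB: "X * B + (A - X * B) = A"
    by (rule eq_matI) (use X B A in auto)
  have AX: "A - X * B \<in> carrier_mat s s"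
    using A X B by (intro minus_carrier_mat mult_carrier_mat)
  \<comment> \<open>The left factor is block unitriangular, so its determinant is 1; the right one
    is block triangular, with the Schur complement on its diagonal.\<close>
  have "four_block_mat M B C A =
      four_block_mat (1\<^sub>m r) (0\<^sub>m r s) X (1\<^sub>m s) * four_block_mat M B (0\<^sub>m s r) (A - X * B)"
    using mult_four_block_mat[of "1\<^sub>m r" r r "0\<^sub>m r s" s X s "1\<^sub>m s" M r B s "0\<^sub>m s r" "A - X * B"]
      M B AX C X XB by (simp add: XM)
  then have "det (four_block_mat M B C A) =
      det (four_block_mat (1\<^sub>m r) (0\<^sub>m r s) X (1\<^sub>m s))
      * det (four_block_mat M B (0\<^sub>m s r) (A - X * B))"
    using det_mult[OF four_block_carrier_mat[of "1\<^sub>m r" r r "1\<^sub>m s" s s]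
        four_block_carrier_mat[of M r r "A - X * B" s s]] M AX by simp
  also have "det (four_block_mat (1\<^sub>m r) (0\<^sub>m r s) X (1\<^sub>m s)) = 1"
    using X by (subst det_four_block_mat_upper_right_zero[of _ r _ s]) auto
  also have "det (four_block_mat M B (0\<^sub>m s r) (A - X * B)) = det M * det (A - X * B)"
    using M AX B by (intro det_four_block_mat_lower_left_zero[of _ r _ s]) auto
  finally show ?thesis by (simp add: X_def)
qed

lemma det_diagonal:
  "det (mat n n (\<lambda>(i, j). if i = j then d i else 0)) = (\<Prod>i<n. d i)" for d :: "nat \<Rightarrow> 'a :: comm_ring_1"
  by (subst det_lower_triangular[of n]) (auto simp: prod_list_diag_prod lessThan_atLeast0)

section \<open>Integrals of polynomials in terms of moments\<close>

text \<open>Linearity is inherited from the four variation integrals. Integrability of the summands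
  matters, since a non-integrable function has integral 0 by default and additivity could
  fail.\<close>

lemma cm_integral_sum:
  assumes "\<And>i. i \<in> I \<Longrightarrow> cm_integrable \<nu> (f i)"
  shows "cm_integral \<nu> (\<lambda>x. \<Sum>i\<in>I. c i * f i x) = (\<Sum>i\<in>I. c i * cm_integral \<nu> (f i))"
proof -
  have "(\<integral>x. (\<Sum>i\<in>I. c i * f i x) \<partial>M) = (\<Sum>i\<in>I. c i * integral\<^sup>L M (f i))"
    if "\<And>i. i \<in> I \<Longrightarrow> integrable M (f i)" for M
    using that by (subst Bochner_Integration.integral_sum) auto
  then show ?thesis
    using assms unfolding cm_integral_def cm_integrable_def
    by (simp add: sum_distrib_left sum.distrib sum_subtractf algebra_simps)
qed

text \<open>Views a measure as a functional on polynomials, so that orthogonality becomes algebra on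
  coefficients and moments.\<close>

definition poly_integral :: "(real set \<Rightarrow> complex) \<Rightarrow> complex poly \<Rightarrow> complex" where
  "poly_integral \<nu> p = cm_integral \<nu> (\<lambda>x. poly p (of_real x))"

text \<open>The bound \<open>n\<close> is free, so that polynomials of different degrees share one
  index range. Stated on coefficients, it also admits \<open>n = 0\<close> for the zero polynomial,
  where \<open>degree p < n\<close> would fail.\<close>

lemma poly_eq_sum:
  fixes p :: "'a :: comm_semiring_1 poly"
  assumes "\<forall>i\<ge>n. coeff p i = 0"
  shows "poly p x = (\<Sum>i<n. coeff p i * x ^ i)"
proof -
  have "poly p x = (\<Sum>i\<le>degree p. coeff p i * x ^ i)" by (rule poly_altdef)
  \<comment> \<open>For \<open>p = 0\<close> and \<open>n = 0\<close> the range
    \<open>{..degree p}\<close> is not contained in \<open>{..<n}\<close>; the union covers this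
    case too.\<close>
  also have "\<dots> = (\<Sum>i\<in>{..degree p} \<union> {..<n}. coeff p i * x ^ i)"
    by (rule sum.mono_neutral_left) (auto simp: coeff_eq_0)
  also have "\<dots> = (\<Sum>i<n. coeff p i * x ^ i)"
    by (rule sum.mono_neutral_right) (auto simp: assms)
  finally show ?thesis .
qed

lemma cm_integrable_poly:
  assumes "finite_moments \<nu>"
  shows "cm_integrable \<nu> (\<lambda>x. poly p (of_real x))"
  using assms unfolding finite_moments_def cm_integrable_def poly_altdef by auto

text \<open>Since \<open>x ^ a * x ^ b = x ^ (a + b)\<close>, pairing two polynomials is a bilinear
  form on their coefficients whose matrix is a Hankel matrix of moments.\<close>

lemma poly_integral_mult:
  assumes \<nu>: "finite_moments \<nu>"
    and p: "\<forall>i\<ge>r. coeff p i = 0" and q: "\<forall>i\<ge>s. coeff q i = 0"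
  shows "poly_integral \<nu> (p * q) = (\<Sum>a<r. \<Sum>b<s. coeff p a * coeff q b * moment \<nu> (a + b))"
proof -
  let ?c = "\<lambda>(a, b). coeff p a * coeff q b"
  have "poly (p * q) x = (\<Sum>ab\<in>{..<r} \<times> {..<s}. ?c ab * x ^ (fst ab + snd ab))" for x
    unfolding poly_mult poly_eq_sum[OF p] poly_eq_sum[OF q] sum_product sum.cartesian_product
    by (intro sum.cong) (auto simp: power_add)
  then have "poly_integral \<nu> (p * q) =
      (\<Sum>ab\<in>{..<r} \<times> {..<s}. ?c ab * moment \<nu> (fst ab + snd ab))"
    using \<nu> unfolding poly_integral_def moment_def
    by (simp only: ) (rule cm_integral_sum, simp add: finite_moments_def)
  then show ?thesis by (simp add: sum.cartesian_product case_prod_beta)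
qed

lemma poly_integral_eq_sum:
  assumes "finite_moments \<nu>" and "\<forall>i\<ge>r. coeff p i = 0"
  shows "poly_integral \<nu> p = (\<Sum>a<r. coeff p a * moment \<nu> a)"
  using poly_integral_mult[of \<nu> r p 1 1] assms by simp

lemma poly_integral_mult_monom:
  assumes "finite_moments \<nu>" and "\<forall>i\<ge>r. coeff p i = 0"
  shows "poly_integral \<nu> (p * monom 1 b) = (\<Sum>a<r. coeff p a * moment \<nu> (a + b))"
  using poly_integral_mult[of \<nu> r p "Suc b" "monom 1 b"] assms by simp

text \<open>Linearity in \<open>q\<close>: this is the passage between orthogonality to powers and
  orthogonality to polynomials.\<close>

lemma poly_integral_mult_eq_sum:
  assumes "finite_moments \<nu>" and "\<forall>i\<ge>s. coeff q i = 0"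
  shows "poly_integral \<nu> (p * q) = (\<Sum>b<s. coeff q b * poly_integral \<nu> (p * monom 1 b))"
proof -
  have p: "\<forall>i\<ge>Suc (degree p). coeff p i = 0"
    by (simp add: coeff_eq_0)
  show ?thesis
    unfolding poly_integral_mult[OF assms(1) p assms(2)] poly_integral_mult_monom[OF assms(1) p]
    by (subst sum.swap) (simp add: sum_distrib_left mult_ac del: sum.lessThan_Suc)
qed

section \<open>Existence and uniqueness of the monic orthogonal polynomials\<close>

text \<open>Orthogonality to the powers below \<open>n\<close> says that the Hankel matrix
  annihilates the coefficient vector of \<open>r\<close>, and that matrix is nonsingular.\<close>

lemma hankel_kernel_trivial:
  assumes \<mu>: "finite_moments \<mu>" and H: "hankel_det \<mu> n \<noteq> 0"
    and r: "\<forall>i\<ge>n. coeff r i = 0"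
    and orth: "\<And>a. a < n \<Longrightarrow> poly_integral \<mu> (r * monom 1 a) = 0"
  shows "r = 0"
proof -
  let ?H = "mat n n (\<lambda>(i, j). moment \<mu> (i + j))"
  let ?v = "vec n (coeff r)"
  have "?H *\<^sub>v ?v = 0\<^sub>v n"
    using orth by (intro eq_vecI)
      (auto simp: scalar_prod_def poly_integral_mult_monom[OF \<mu> r] lessThan_atLeast0 mult.commute add.commute)
  then have "?v = 0\<^sub>v n"
    using H det_0_iff_vec_prod_zero_field[of ?H n] vec_carrier[of n "coeff r"]
    unfolding hankel_det_def by fastforce
  then have "coeff r i = 0" for i
    using r by (cases "i < n") (auto dest!: arg_cong[of _ _ "\<lambda>v. v $ i"])
  then show ?thesis by (simp add: poly_eq_iff)
qed

text \<open>Testing against powers gives linear equations for a single polynomial, instead of a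
  condition on a whole sequence.\<close>

definition monic_orth :: "(real set \<Rightarrow> complex) \<Rightarrow> nat \<Rightarrow> complex poly \<Rightarrow> bool" where
  "monic_orth \<mu> n p \<longleftrightarrow> degree p = n \<and> lead_coeff p = 1 \<and>
     (\<forall>a<n. poly_integral \<mu> (p * monom 1 a) = 0)"

text \<open>The \<open>n\<close> lower coefficients solve a linear system whose matrix is the Hankel
  matrix of order \<open>n\<close>, which is invertible.\<close>

lemma monic_orth_exists:
  assumes \<mu>: "finite_moments \<mu>" and H: "hankel_det \<mu> n \<noteq> 0"
  shows "\<exists>p. monic_orth \<mu> n p"
proof -
  let ?H = "mat n n (\<lambda>(i, j). moment \<mu> (i + j))"
  have "?H \<in> Units (ring_mat TYPE(complex) n ())"
    using H by (intro det_non_zero_imp_unit) (auto simp: hankel_det_def)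
  then obtain B where B: "B \<in> carrier_mat n n" "?H * B = 1\<^sub>m n"
    by (auto simp: Units_def ring_mat_def)
  \<comment> \<open>The right-hand side is the contribution of the leading term
    \<open>x ^ n\<close>, moved across.\<close>
  define w where "w = vec n (\<lambda>a. - moment \<mu> (a + n))"
  define c where "c = B *\<^sub>v w"
  have c: "c \<in> carrier_vec n" and w: "w \<in> carrier_vec n" using B by (auto simp: c_def w_def)
  have "?H *\<^sub>v c = (?H * B) *\<^sub>v w"
    unfolding c_def by (rule assoc_mult_mat_vec[symmetric]) (use B w in auto)
  then have Hc: "?H *\<^sub>v c = w" using B w by simp
  define p where "p = Abs_poly (\<lambda>i. if i < n then c $ i else if i = n then 1 else 0)"
  have p: "coeff p i = (if i < n then c $ i else if i = n then 1 else 0)" for i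
    unfolding p_def by (subst Abs_poly_inverse) (auto simp: MOST_nat intro!: exI[of _ n])
  have deg: "degree p = n"
    by (intro antisym degree_le le_degree) (auto simp: p)
  have "poly_integral \<mu> (p * monom 1 a) = 0" if a: "a < n" for a
  proof -
    have "(\<Sum>b<n. c $ b * moment \<mu> (a + b)) = (?H *\<^sub>v c) $ a"
      using a c by (simp add: scalar_prod_def lessThan_atLeast0 mult.commute)
    also have "\<dots> = - moment \<mu> (a + n)" using a by (simp add: Hc w_def)
    finally show ?thesis
      using poly_integral_mult_monom[of \<mu> "Suc n" p a] \<mu> by (simp add: p add.commute)
  qed
  then show ?thesis using deg by (intro exI[of _ p]) (simp add: monic_orth_def p)
qed

text \<open>The leading terms of two candidates cancel, so their difference has only coefficients
  below \<open>n\<close> and lies in the trivial kernel of the Hankel matrix.\<close>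

lemma monic_orth_unique:
  assumes \<mu>: "finite_moments \<mu>" and H: "hankel_det \<mu> n \<noteq> 0"
    and p: "monic_orth \<mu> n p" and q: "monic_orth \<mu> n q"
  shows "p = q"
proof -
  have "p - q = 0"
  proof (rule hankel_kernel_trivial[OF \<mu> H])
    have "coeff (p - q) i = 0" if "i \<ge> n" for i
      using p q that by (cases "i = n") (auto simp: monic_orth_def coeff_eq_0)
    then show "\<forall>i\<ge>n. coeff (p - q) i = 0" by blast
  next
    fix a assume a: "a < n"
    \<comment> \<open>The common bound \<open>Suc n\<close> lets the three expansions be compared
      term by term.\<close>
    have co: "\<forall>i\<ge>Suc n. coeff p i = 0" "\<forall>i\<ge>Suc n. coeff q i = 0"
        "\<forall>i\<ge>Suc n. coeff (p - q) i = 0"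
      using p q by (auto simp: monic_orth_def coeff_eq_0)
    show "poly_integral \<mu> ((p - q) * monom 1 a) = 0"
      using p q a
        poly_integral_mult_monom[OF \<mu> co(1), of a]
        poly_integral_mult_monom[OF \<mu> co(2), of a]
        poly_integral_mult_monom[OF \<mu> co(3), of a]
      by (simp add: monic_orth_def sum_subtractf left_diff_distrib)
  qed
  then show ?thesis by simp
qed

lemma poly_integral_monic_orth:
  assumes "finite_moments \<mu>" and "monic_orth \<mu> n p" and "\<forall>i\<ge>n. coeff q i = 0"
  shows "poly_integral \<mu> (p * q) = 0"
  using assms by (simp add: poly_integral_mult_eq_sum[of \<mu> n q p] monic_orth_def)

text \<open>Monic polynomials of degrees 0 to \<open>i - 1\<close> span the same space as the powers
  below \<open>i\<close>. The condition on the sequence thus splits into one condition per degree,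
  each with a unique solution.\<close>

lemma monic_orth_upto_iff:
  assumes \<mu>: "finite_moments \<mu>"
  shows "monic_orth_upto \<mu> k P \<longleftrightarrow> (\<forall>i\<le>k. monic_orth \<mu> i (P i))"
proof
  assume P: "\<forall>i\<le>k. monic_orth \<mu> i (P i)"
  have *: "poly_integral \<mu> (P i * P j) = 0" if "j < i" "i \<le> k" for i j
    using P that by (intro poly_integral_monic_orth[OF \<mu>, of i]) (auto simp: monic_orth_def coeff_eq_0)
  have "poly_integral \<mu> (P i * P j) = 0" if "i \<noteq> j" "i \<le> k" "j \<le> k" for i j
    using *[of i j] *[of j i] that by (cases "i < j") (auto simp: mult.commute)
  then show "monic_orth_upto \<mu> k P"
    using P unfolding monic_orth_upto_def monic_orth_def poly_integral_def
    by (auto intro!: exI[of _ "\<lambda>i. poly_integral \<mu> (P i * P i)"] simp: poly_integral_def)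
next
  assume "monic_orth_upto \<mu> k P"
  then have P: "degree (P i) = i" "coeff (P i) i = 1" if "i \<le> k" for i
    using that by (auto simp: monic_orth_upto_def)
  from \<open>monic_orth_upto \<mu> k P\<close> have orth: "poly_integral \<mu> (P i * P j) = 0"
    if "i \<le> k" "j < i" for i j
    using that unfolding monic_orth_upto_def poly_integral_def poly_mult by force
  have "poly_integral \<mu> (P i * monom 1 a) = 0" if i: "i \<le> k" and "a < i" for i a
    using \<open>a < i\<close>
  proof (induction a rule: less_induct)
    case (less a)
    \<comment> \<open>\<open>P a\<close> is \<open>x\<^sup>a\<close> plus lower powers, on which the induction hypothesis applies.\<close>
    have "poly_integral \<mu> (P i * P a) =
        (\<Sum>b<Suc a. coeff (P a) b * poly_integral \<mu> (P i * monom 1 b))"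
      by (rule poly_integral_mult_eq_sum[OF \<mu>]) (use less i P in \<open>auto simp: coeff_eq_0\<close>)
    then show ?case using less i P orth by simp
  qed
  then show "\<forall>i\<le>k. monic_orth \<mu> i (P i)" using P by (simp add: monic_orth_def)
qed

text \<open>Justifies the definite description in \<open>orth_poly\<close>: solutions in all degrees
  up to \<open>k\<close> are chosen to form a sequence.\<close>

lemma monic_orth_orth_poly:
  assumes \<mu>: "finite_moments \<mu>" and H: "\<And>i. i \<le> k \<Longrightarrow> hankel_det \<mu> i \<noteq> 0"
  shows "monic_orth \<mu> k (orth_poly \<mu> k)"
proof -
  have "\<exists>P. \<forall>i\<le>k. monic_orth \<mu> i (P i)"
    using monic_orth_exists[OF \<mu> H] by metis
  then obtain P where P: "\<forall>i\<le>k. monic_orth \<mu> i (P i)" ..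
  \<comment> \<open>Such sequences are arbitrary beyond \<open>k\<close>, but the description
    concerns only the value at \<open>k\<close>, so uniqueness in degree \<open>k\<close> settles
    it.\<close>
  have "orth_poly \<mu> k = P k"
    unfolding orth_poly_def monic_orth_upto_iff[OF \<mu>]
    using P monic_orth_unique[OF \<mu> H[OF order_refl]] by (intro the_equality) auto
  then show ?thesis using P by simp
qed

lemma poly_integral_orth_poly:
  assumes \<mu>: "finite_moments \<mu>" and H: "\<And>i. i < N \<Longrightarrow> hankel_det \<mu> i \<noteq> 0"
    and "k < N" and "l < N"
  shows "poly_integral \<mu> (orth_poly \<mu> k * orth_poly \<mu> l) = (if k = l then orth_norm \<mu> k else 0)"
proof -
  have P: "monic_orth \<mu> i (orth_poly \<mu> i)" if "i < N" for i
    using that by (intro monic_orth_orth_poly[OF \<mu>] H) simp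
  have "poly_integral \<mu> (orth_poly \<mu> i * orth_poly \<mu> j) = 0" if "j < i" "i < N" for i j
    using P[of i] P[of j] that
    by (intro poly_integral_monic_orth[OF \<mu>, of i]) (auto simp: monic_orth_def coeff_eq_0)
  from this[of k l] this[of l k] show ?thesis
    using assms(3,4) by (cases k l rule: linorder_cases)
      (auto simp: orth_norm_def poly_integral_def mult.commute)
qed

section \<open>Diagonalisation of the Hankel matrix\<close>

definition orth_coeff_mat :: "(real set \<Rightarrow> complex) \<Rightarrow> nat \<Rightarrow> complex mat" where
  "orth_coeff_mat \<mu> N = mat N N (\<lambda>(k, i). coeff (orth_poly \<mu> k) i)"

lemma orth_coeff_mat_carrier [simp]: "orth_coeff_mat \<mu> N \<in> carrier_mat N N"
  by (simp add: orth_coeff_mat_def)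

text \<open>The matrix is lower triangular because the degree of \<open>orth_poly \<mu> k\<close> is
  \<open>k\<close>, with unit diagonal because it is monic. Multiplying by it replaces powers by
  orthogonal polynomials under the integral.\<close>

lemma
  assumes \<mu>: "finite_moments \<mu>" and H: "\<And>i. i < N \<Longrightarrow> hankel_det \<mu> i \<noteq> 0"
  shows det_orth_coeff_mat: "det (orth_coeff_mat \<mu> N) = 1"
    and orth_coeff_mat_congruence:
      "orth_coeff_mat \<mu> N * mat N N (\<lambda>(i, j). moment \<mu> (i + j)) * transpose_mat (orth_coeff_mat \<mu> N) =
        mat N N (\<lambda>(k, l). if k = l then orth_norm \<mu> k else 0)" (is "?U * ?M * ?UT = ?D")
    and orth_coeff_mat_moments:
      "(\<And>k. k < s \<Longrightarrow> finite_moments (\<nu> k)) \<Longrightarrow>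
        orth_coeff_mat \<mu> N * mat N s (\<lambda>(i, k). moment (\<nu> k) i) =
        mat N s (\<lambda>(l, k). poly_integral (\<nu> k) (orth_poly \<mu> l))"
proof -
  have P: "monic_orth \<mu> i (orth_poly \<mu> i)" if "i < N" for i
    using that by (intro monic_orth_orth_poly[OF \<mu>] H) simp
  have co: "coeff (orth_poly \<mu> i) j = 0" if "i < N" "i < j" for i j
    using P[OF that(1)] that(2) by (auto simp: monic_orth_def coeff_eq_0)
  have coN: "\<forall>j\<ge>N. coeff (orth_poly \<mu> i) j = 0" if "i < N" for i
    using co that by simp
  have "coeff (orth_poly \<mu> i) i = 1" if "i < N" for i
    using P[OF that] by (auto simp: monic_orth_def)
  then show "det (orth_coeff_mat \<mu> N) = 1"
    using co by (subst det_lower_triangular[of N])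
      (simp_all add: orth_coeff_mat_def prod_list_diag_prod)
  show "?U * ?M * ?UT = ?D"
  proof (rule eq_matI)
    fix k l assume "k < dim_row ?D" "l < dim_col ?D"
    then have kl: "k < N" "l < N" by auto
    \<comment> \<open>The inner sum is the integral of \<open>orth_poly \<mu> k\<close> times the
      power \<open>b\<close>; the outer one assembles these powers into
      \<open>orth_poly \<mu> l\<close>.\<close>
    have "(?U * ?M * ?UT) $$ (k, l) =
        (\<Sum>b<N. (\<Sum>a<N. coeff (orth_poly \<mu> k) a * moment \<mu> (a + b)) * coeff (orth_poly \<mu> l) b)"
      using kl by (simp add: orth_coeff_mat_def scalar_prod_def lessThan_atLeast0)
    also have "\<dots> = poly_integral \<mu> (orth_poly \<mu> k * orth_poly \<mu> l)"
      using kl by (simp add: poly_integral_mult_eq_sum[OF \<mu> coN] poly_integral_mult_monom[OF \<mu> coN] mult.commute)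
    finally show "(?U * ?M * ?UT) $$ (k, l) = ?D $$ (k, l)"
      using kl poly_integral_orth_poly[OF \<mu> H] by simp
  qed (auto simp: orth_coeff_mat_def)
  show "?U * mat N s (\<lambda>(i, k). moment (\<nu> k) i) =
      mat N s (\<lambda>(l, k). poly_integral (\<nu> k) (orth_poly \<mu> l))"
    if \<nu>: "\<And>k. k < s \<Longrightarrow> finite_moments (\<nu> k)"
    by (rule eq_matI)
       (auto simp: orth_coeff_mat_def scalar_prod_def lessThan_atLeast0 poly_integral_eq_sum[OF \<nu> coN])
qed

text \<open>Take determinants in the congruence. If the Hankel determinant of order \<open>N\<close>
  is nonzero too, all norms below \<open>N\<close> are nonzero.\<close>

lemma hankel_det_eq_prod_orth_norm:
  assumes \<mu>: "finite_moments \<mu>" and H: "\<And>i. i < N \<Longrightarrow> hankel_det \<mu> i \<noteq> 0"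
  shows "hankel_det \<mu> N = (\<Prod>k<N. orth_norm \<mu> k)"
proof -
  let ?U = "orth_coeff_mat \<mu> N" and ?M = "mat N N (\<lambda>(i, j). moment \<mu> (i + j))"
  have "det (?U * ?M * transpose_mat ?U) = det ?U * det ?M * det ?U"
    using det_mult[of ?U N ?M] det_mult[of "?U * ?M" N "transpose_mat ?U"]
    by (simp add: det_transpose[of _ N] mult_carrier_mat[of _ N N])
  moreover have "det (?U * ?M * transpose_mat ?U) = (\<Prod>k<N. orth_norm \<mu> k)"
    using orth_coeff_mat_congruence[OF \<mu> H] det_diagonal[of N "orth_norm \<mu>"] by simp
  ultimately show ?thesis
    by (simp add: det_orth_coeff_mat[OF \<mu> H] hankel_det_def)
qed

section \<open>The integrated kernel and the framed determinant\<close>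

text \<open>The kernel is a finite sum of products of a function of \<open>x\<close> and a function
  of \<open>y\<close>, so linearity suffices and no Fubini argument arises.\<close>

lemma cm_integral_CD_kernel:
  assumes \<nu>: "finite_moments \<nu>" and \<eta>: "finite_moments \<eta>"
  shows "cm_integral \<eta> (\<lambda>y. cm_integral \<nu> (\<lambda>x. CD_kernel \<mu> n x y)) =
    (\<Sum>k\<le>n. poly_integral \<eta> (orth_poly \<mu> k) * poly_integral \<nu> (orth_poly \<mu> k) / orth_norm \<mu> k)"
proof -
  let ?P = "orth_poly \<mu>"
  have "cm_integral \<nu> (\<lambda>x. CD_kernel \<mu> n x y) =
      (\<Sum>k\<le>n. poly_integral \<nu> (?P k) / orth_norm \<mu> k * poly (?P k) (of_real y))" for y
    using cm_integral_sum[of "{..n}" \<nu> "\<lambda>k x. poly (?P k) (of_real x)"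
        "\<lambda>k. poly (?P k) (of_real y) / orth_norm \<mu> k"] cm_integrable_poly[OF \<nu>]
    by (simp add: CD_kernel_def poly_integral_def mult_ac)
  then show ?thesis
    using cm_integral_sum[of "{..n}" \<eta> "\<lambda>k y. poly (?P k) (of_real y)"
        "\<lambda>k. poly_integral \<nu> (?P k) / orth_norm \<mu> k"] cm_integrable_poly[OF \<eta>]
    by (simp add: poly_integral_def mult_ac)
qed

lemma det_four_block_congruence:
  fixes M :: "'a :: idom mat"
  assumes U: "U \<in> carrier_mat r r" and V: "V \<in> carrier_mat r r" and M: "M \<in> carrier_mat r r"
    and B: "B \<in> carrier_mat r s" and C: "C \<in> carrier_mat s r" and A: "A \<in> carrier_mat s s"
  shows "det (four_block_mat (U * M * V) (U * B) (C * V) A) =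
    det U * det (four_block_mat M B C A) * det V"
proof -
  \<comment> \<open>Padding by an identity block makes the multiplication act on the first
    \<open>r\<close> rows or columns, which leaves \<open>A\<close> fixed.\<close>
  define E where "E X = four_block_mat X (0\<^sub>m r s) (0\<^sub>m s r) (1\<^sub>m s)" for X :: "'a mat"
  have E: "E X \<in> carrier_mat (r + s) (r + s)" "det (E X) = det X" if "X \<in> carrier_mat r r" for X
    using that by (auto simp: E_def det_four_block_mat_upper_right_zero[of X r "0\<^sub>m r s" s])
  have F: "four_block_mat M B C A \<in> carrier_mat (r + s) (r + s)" using M A by simp
  have "E U * four_block_mat M B C A = four_block_mat (U * M) (U * B) C A"
    unfolding E_def by (subst mult_four_block_mat[of _ r r _ s _ s _ _ r _ s]) (use U M B C A in auto)
  also have "\<dots> * E V = four_block_mat (U * M * V) (U * B) (C * V) A"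
    unfolding E_def by (subst mult_four_block_mat[of _ r r _ s _ s _ _ r _ s]) (use U V M B C A in auto)
  finally show ?thesis
    using det_mult[OF mult_carrier_mat[OF E(1)[OF U] F] E(1)[OF V]] det_mult[OF E(1)[OF U] F]
    by (simp add: E U V)
qed

theorem corollary1p14:
  fixes n m :: nat
    and \<mu> :: "real set \<Rightarrow> complex"
    and \<nu> \<eta> :: "nat \<Rightarrow> real set \<Rightarrow> complex"
    and A :: "complex mat"
  assumes "1 \<le> m" and "m < n"
    and "complex_measure \<mu>" and "finite_moments \<mu>"
    and "\<And>k. 1 \<le> k \<Longrightarrow> k \<le> n - m \<Longrightarrow> hankel_det \<mu> k \<noteq> 0"
    and "\<And>k. k < m \<Longrightarrow> complex_measure (\<nu> k) \<and> finite_moments (\<nu> k)"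
    and "\<And>j. j < m \<Longrightarrow> complex_measure (\<eta> j) \<and> finite_moments (\<eta> j)"
    and "A \<in> carrier_mat m m"
  shows "framed_hankel_det n m \<mu> \<nu> \<eta> A =
    hankel_det \<mu> (n - m) *
    det (A - mat m m (\<lambda>(j, k).
      cm_integral (\<eta> j) (\<lambda>y. cm_integral (\<nu> k) (\<lambda>x. CD_kernel \<mu> (n - m - 1) x y))))"
proof -
  define N where "N = n - m"
  let ?P = "orth_poly \<mu>" and ?h = "orth_norm \<mu>"
  let ?U = "orth_coeff_mat \<mu> N" and ?M = "mat N N (\<lambda>(i, j). moment \<mu> (i + j))"
  let ?B = "mat N m (\<lambda>(i, k). moment (\<nu> k) i)" and ?C = "mat m N (\<lambda>(j, i). moment (\<eta> j) i)"
  let ?B' = "mat N m (\<lambda>(l, k). poly_integral (\<nu> k) (?P l))"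
  let ?C' = "mat m N (\<lambda>(j, l). poly_integral (\<eta> j) (?P l))"
  let ?D = "mat N N (\<lambda>(k, l). if k = l then ?h k else 0)"
  let ?Di = "mat N N (\<lambda>(k, l). if k = l then 1 / ?h k else 0)"
  let ?K = "mat m m (\<lambda>(j, k).
      cm_integral (\<eta> j) (\<lambda>y. cm_integral (\<nu> k) (\<lambda>x. CD_kernel \<mu> (n - m - 1) x y)))"
  note \<mu> = \<open>finite_moments \<mu>\<close> and A = \<open>A \<in> carrier_mat m m\<close>
  have \<nu>: "finite_moments (\<nu> k)" and \<eta>: "finite_moments (\<eta> k)" if "k < m" for k
    using assms(6,7) that by auto
  \<comment> \<open>The hypothesis starts at order 1; at order 0 the empty determinant is 1.\<close>
  have H: "hankel_det \<mu> i \<noteq> 0" if "i \<le> N" for i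
    using assms(5)[of i] that by (cases "i = 0") (auto simp: N_def hankel_det_def)
  then have H': "hankel_det \<mu> i \<noteq> 0" if "i < N" for i using that by simp
  \<comment> \<open>Nonvanishing at order \<open>N\<close> itself enters here: the norms are factors
    of that determinant.\<close>
  have h: "?h k \<noteq> 0" if "k < N" for k
    using H[of N] that by (auto simp: hankel_det_eq_prod_orth_norm[OF \<mu> H'])
  \<comment> \<open>The column operations on the lower frame are the transposed row operations for
    the measures \<open>\<eta>\<close>.\<close>
  have "?C * transpose_mat ?U = transpose_mat (?U * mat N m (\<lambda>(i, j). moment (\<eta> j) i))"
    by (subst transpose_mult[of _ N N _ m]) (auto intro!: arg_cong2[of _ _ _ _ times])
  also have "\<dots> = transpose_mat (mat N m (\<lambda>(l, j). poly_integral (\<eta> j) (?P l)))"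
    by (simp only: orth_coeff_mat_moments[OF \<mu> H' \<eta>])
  also have "\<dots> = ?C'" by (rule eq_matI) auto
  finally have CU: "?C * transpose_mat ?U = ?C'" .
  have "framed_hankel_det n m \<mu> \<nu> \<eta> A = det (four_block_mat ?D ?B' ?C' A)"
    using det_four_block_congruence[of ?U N "transpose_mat ?U" ?M ?B m ?C A] A
    by (simp add: framed_hankel_det_def N_def[symmetric] CU det_transpose[of _ N]
        det_orth_coeff_mat[OF \<mu> H'] orth_coeff_mat_congruence[OF \<mu> H']
        orth_coeff_mat_moments[OF \<mu> H' \<nu>])
  also have "\<dots> = det ?D * det (A - ?C' * ?Di * ?B')"
  proof (rule det_schur_complement)
    show "?Di * ?D = 1\<^sub>m N"
      by (rule eq_matI) (auto simp: scalar_prod_def h if_distrib[of "\<lambda>x. x * y" for y] cong: if_cong)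
  qed (use A in auto)
  also have "?C' * ?Di * ?B' = ?K"
  proof (rule eq_matI)
    fix j k assume "j < dim_row ?K" "k < dim_col ?K"
    then have jk: "j < m" "k < m" by auto
    have "(?C' * ?Di * ?B') $$ (j, k) =
        (\<Sum>l<N. poly_integral (\<eta> j) (?P l) / ?h l * poly_integral (\<nu> k) (?P l))"
      using jk by (simp add: scalar_prod_def lessThan_atLeast0 if_distrib cong: if_cong)
    \<comment> \<open>With truncated subtraction this requires \<open>N\<close> to be positive,
      which is \<open>m < n\<close>.\<close>
    also have "{..<N} = {..n - m - 1}"
      using \<open>m < n\<close> by (auto simp: N_def)
    finally show "(?C' * ?Di * ?B') $$ (j, k) = ?K $$ (j, k)"
      using jk by (simp add: cm_integral_CD_kernel[OF \<nu> \<eta>])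
  qed auto
  also have "det ?D = hankel_det \<mu> (n - m)"
    by (simp add: hankel_det_eq_prod_orth_norm[OF \<mu> H'] det_diagonal N_def[symmetric])
  finally show ?thesis .
qed

end
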